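(* The set $V$ is invariant under $T_J$, $T_{GS}$, and $T_{GSJ}$. That is, $$T_JV\subset V,\qquad T_{GS}V\subset V,\qquad T_{GSJ}V\subset V.$$
   Context: Consider an infinite horizon Markov decision process with finite state set $S=\{1,\dots,|S|\}$ (with this fixed ordering), a finite (nonempty) set of actions $A(i)$ for each $i\in S$, real immediate rewards $r(i,a)$ for $i\in S$, $a\in A(i)$, transition probabilities $p_{ij}(a)$ for $i,j\in S$, $a\in A(i)$ (so $p_{ij}(a)\ge 0$ and $\sum_{j\in S}p_{ij}(a)=1$), and discount factor $\lambda$ with $0\le\lambda<1$. Inequalities between vectors in $\mathbb{R}^{|S|}$ are component-wise. The standard operator $T$ on $\mathbb{R}^{|S|}$ is $$(Tv)_i=\max_{a\in A(i)}\Bigl\{r(i,a)+\lambda\sum_{j\in S}p_{ij}(a)v_j\Bigr\},\quad i\in S,$$ and $V=\{v\in\mathbb{R}^{|S|}\mid v\ge Tv\}$. The Jacobi operator $T_J$, Gauss-Seidel operator $T_{GS}$ and Gauss-Seidel-Jacobi operator $T_{GSJ}$ on $\mathbb{R}^{|S|}$ are defined as follows (the last two recursively in $i=1,2,\dots,|S|$): $$(T_Jv)_i=\max_{a\in A(i)}\frac{r(i,a)+\lambda\sum_{j\ne i}p_{ij}(a)v_j}{1-\lambda p_{ii}(a)};$$ $w=T_{GS}v$ where $$w_i=\max_{a\in A(i)}\Bigl\{r(i,a)+\lambda\sum_{j<i}p_{ij}(a)w_j+\lambda\sum_{j\ge i}p_{ij}(a)v_j\Bigr\};$$ $w=T_{GSJ}v$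 where $$w_i=\max_{a\in A(i)}\frac{r(i,a)+\lambda\sum_{j<i}p_{ij}(a)w_j+\lambda\sum_{j>i}p_{ij}(a)v_j}{1-\lambda p_{ii}(a)}.$$ *)

theory Defs
  imports "HOL-Analysis.Analysis"
begin

text \<open>The state set is an arbitrary finite linearly ordered type \<open>'s\<close>, which plays the role of
  \<open>{1, \<dots>, |S|}\<close> with its fixed ordering; \<open>real ^ 's\<close> is the space of value vectors, with the
  library's component-wise order. The action sets of all states are subsets of one type \<open>'a\<close>.
  Rewards and transition probabilities at \<open>(i, a)\<close> with \<open>a \<notin> actions M i\<close> are irrelevant and
  unconstrained; \<open>prob M i a j\<close> is the probability of moving from \<open>i\<close> to \<open>j\<close> under \<open>a\<close>.\<close>

record ('s, 'a) mdp =
  actions :: "'s \<Rightarrow> 'a set"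
  reward :: "'s \<Rightarrow> 'a \<Rightarrow> real"
  prob :: "'s \<Rightarrow> 'a \<Rightarrow> 's \<Rightarrow> real"
  discount :: real

definition discounted_mdp :: "('s::finite, 'a) mdp \<Rightarrow> bool" where
  "discounted_mdp M \<longleftrightarrow>
     (\<forall>i. finite (actions M i) \<and> actions M i \<noteq> {}) \<and>
     (\<forall>i. \<forall>a\<in>actions M i. (\<forall>j. 0 \<le> prob M i a j) \<and> (\<Sum>j\<in>UNIV. prob M i a j) = 1) \<and>
     0 \<le> discount M \<and> discount M < 1"

definition T :: "('s::finite, 'a) mdp \<Rightarrow> real ^ 's \<Rightarrow> real ^ 's" where
  "T M v = (\<chi> i. MAX a\<in>actions M i.
     reward M i a + discount M * (\<Sum>j\<in>UNIV. prob M i a j * v $ j))"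

definition V :: "('s::finite, 'a) mdp \<Rightarrow> (real ^ 's) set" where
  "V M = {v. v \<ge> T M v}"

definition T_J :: "('s::finite, 'a) mdp \<Rightarrow> real ^ 's \<Rightarrow> real ^ 's" where
  "T_J M v = (\<chi> i. MAX a\<in>actions M i.
     (reward M i a + discount M * (\<Sum>j\<in>-{i}. prob M i a j * v $ j))
       / (1 - discount M * prob M i a i))"

lemma card_lessThan_mono:
  fixes i j :: "'s::{finite, linorder}"
  assumes "j < i"
  shows "card {..<j} < card {..<i}"
  using assms by (intro psubset_card_mono) auto

function GS_comp :: "('s::{finite, linorder}, 'a) mdp \<Rightarrow> (real, 's) vec \<Rightarrow> 's \<Rightarrow> real" where
  "GS_comp M v i = (MAX a\<in>actions M i.
     reward M i a + discount M * (\<Sum>j\<in>{..<i}. prob M i a j * GS_comp M v j)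
       + discount M * (\<Sum>j\<in>{i..}. prob M i a j * v $ j))"
  by pat_completeness auto
termination
  by (relation "Wellfounded.measure (\<lambda>(M, v, i). card {..<i})") (auto intro: card_lessThan_mono)

declare GS_comp.simps [simp del]

definition T_GS :: "('s::{finite, linorder}, 'a) mdp \<Rightarrow> (real, 's) vec \<Rightarrow> (real, 's) vec" where
  "T_GS M v = (\<chi> i. GS_comp M v i)"

function GSJ_comp :: "('s::{finite, linorder}, 'a) mdp \<Rightarrow> (real, 's) vec \<Rightarrow> 's \<Rightarrow> real" where
  "GSJ_comp M v i = (MAX a\<in>actions M i.
     (reward M i a + discount M * (\<Sum>j\<in>{..<i}. prob M i a j * GSJ_comp M v j)
       + discount M * (\<Sum>j\<in>{i<..}. prob M i a j * v $ j))
       / (1 - discount M * prob M i a i))"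
  by pat_completeness auto
termination
  by (relation "Wellfounded.measure (\<lambda>(M, v, i). card {..<i})") (auto intro: card_lessThan_mono)

declare GSJ_comp.simps [simp del]

definition T_GSJ :: "('s::{finite, linorder}, 'a) mdp \<Rightarrow> (real, 's) vec \<Rightarrow> (real, 's) vec" where
  "T_GSJ M v = (\<chi> i. GSJ_comp M v i)"

lemma T_GS_nth:
  "T_GS M v $ i = (MAX a\<in>actions M i.
     reward M i a + discount M * (\<Sum>j\<in>{..<i}. prob M i a j * T_GS M v $ j)
       + discount M * (\<Sum>j\<in>{i..}. prob M i a j * v $ j))"
  unfolding T_GS_def by (simp add: GS_comp.simps[of M v i])

lemma T_GSJ_nth:
  "T_GSJ M v $ i = (MAX a\<in>actions M i.
     (reward M i a + discount M * (\<Sum>j\<in>{..<i}. prob M i a j * T_GSJ M v $ j)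
       + discount M * (\<Sum>j\<in>{i<..}. prob M i a j * v $ j))
       / (1 - discount M * prob M i a i))"
  unfolding T_GSJ_def by (simp add: GSJ_comp.simps[of M v i])

end

theory Submission
  imports Defs
begin

text \<open>
  For a fixed \<open>v \<in> V M\<close>, each of the three operators produces a vector \<open>w\<close> that solves one and the
  same kind of equation: \<open>w\<^sub>i\<close> is the maximum over \<open>a\<close> of the one-step value
  \<open>r(i,a) + \<lambda> \<Sum>\<^sub>j p\<^sub>i\<^sub>j(a) u\<^sub>j\<close>, where every entry of \<open>u = u\<^sub>i\<close> is copied from \<open>v\<close> (an old value) or
  from \<open>w\<close> (a new value). Jacobi uses the new value exactly at \<open>j = i\<close>, Gauss-Seidel exactly for
  \<open>j < i\<close>, and Gauss-Seidel-Jacobi exactly for \<open>j \<le> i\<close>. For the two Jacobi variants the quotient by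
  \<open>1 - \<lambda> p\<^sub>i\<^sub>i(a)\<close> is what remains after solving this implicit equation for \<open>w\<^sub>i\<close>
  (\<open>Max_quotient_fixpoint\<close>).

  Every such \<open>w\<close> satisfies \<open>w \<le> v\<close> (\<open>mixed_update_le\<close>): at the first state where this failed, the
  mixed vector \<open>u\<close> could exceed \<open>v\<close> only at that state itself, and discounting would shrink the
  excess strictly. Then \<open>w \<le> u\<^sub>i\<close>, so monotonicity gives
  \<open>(T w)\<^sub>i \<le> max\<^sub>a (r(i,a) + \<lambda> \<Sum>\<^sub>j p\<^sub>i\<^sub>j(a) (u\<^sub>i)\<^sub>j) = w\<^sub>i\<close>, that is, \<open>w \<in> V\<close> (\<open>mixed_update_in_V\<close>).
\<close>

definition action_value :: "('s::finite, 'a) mdp \<Rightarrow> 's \<Rightarrow> 'a \<Rightarrow> ('s \<Rightarrow> real) \<Rightarrow> real" where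
  "action_value M i a x = reward M i a + discount M * (\<Sum>j\<in>UNIV. prob M i a j * x j)"

lemma action_value_mono:
  assumes "discounted_mdp M" "a \<in> actions M i" "\<And>j. x j \<le> y j"
  shows "action_value M i a x \<le> action_value M i a y"
  using assms unfolding action_value_def discounted_mdp_def
  by (intro add_left_mono mult_left_mono sum_mono) auto

lemma action_value_split:
  assumes "A \<inter> B = {}" "A \<union> B = UNIV"
  shows "action_value M i a x =
    reward M i a + discount M * (\<Sum>j\<in>A. prob M i a j * x j)
      + discount M * (\<Sum>j\<in>B. prob M i a j * x j)"
proof -
  have "(\<Sum>j\<in>UNIV. prob M i a j * x j) =
      (\<Sum>j\<in>A. prob M i a j * x j) + (\<Sum>j\<in>B. prob M i a j * x j)"
    using sum.union_disjoint[of A B "\<lambda>j. prob M i a j * x j"] assms by simp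
  then show ?thesis
    by (simp add: action_value_def algebra_simps)
qed

lemma action_value_add_single:
  "action_value M i a (\<lambda>j. x j + (if j = k then d else 0)) =
    action_value M i a x + discount M * prob M i a k * d"
proof -
  have "prob M i a j * (x j + (if j = k then d else 0)) =
      prob M i a j * x j + (if j = k then prob M i a k * d else 0)" for j
    by (simp add: algebra_simps)
  then show ?thesis
    by (simp add: action_value_def sum.distrib algebra_simps)
qed

lemma discount_prob_less_1:
  assumes "discounted_mdp M" "a \<in> actions M i"
  shows "discount M * prob M i a j < 1"
proof -
  have p: "0 \<le> prob M i a k" for k
    using assms by (auto simp: discounted_mdp_def)
  have "prob M i a j \<le> (\<Sum>k\<in>UNIV. prob M i a k)"
    using p by (intro member_le_sum) auto
  also have "\<dots> = 1"
    using assms by (auto simp: discounted_mdp_def)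
  finally have "discount M * prob M i a j \<le> discount M * 1"
    using assms by (intro mult_left_mono) (auto simp: discounted_mdp_def)
  then show ?thesis
    using assms by (simp add: discounted_mdp_def)
qed

lemma mem_V_iff:
  assumes "discounted_mdp M"
  shows "v \<in> V M \<longleftrightarrow> (\<forall>i. \<forall>a\<in>actions M i. action_value M i a (($) v) \<le> v $ i)"
  using assms
  by (simp add: V_def T_def less_eq_vec_def action_value_def discounted_mdp_def)

text \<open>
  With \<open>c a < 1\<close>, the inequality \<open>x a / (1 - c a) \<le> w\<close> is equivalent to \<open>x a + c a * w \<le> w\<close>, and
  likewise with equality, so a maximizing action of the quotients also attains the maximum in the
  implicit equation.
\<close>

lemma Max_quotient_fixpoint:
  fixes x c :: "'a \<Rightarrow> real"
  assumes "finite A" "A \<noteq> {}" "\<And>a. a \<in> A \<Longrightarrow> c a < 1"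
    and w: "w = (MAX a\<in>A. x a / (1 - c a))"
  shows "w = (MAX a\<in>A. x a + c a * w)"
proof -
  have upper: "x a + c a * w \<le> w" if "a \<in> A" for a
  proof -
    have "x a / (1 - c a) \<le> w"
      unfolding w using assms that by (intro Max_ge) auto
    then show ?thesis
      using assms(3)[OF that] by (simp add: pos_divide_le_eq algebra_simps)
  qed
  have "w \<in> (\<lambda>a. x a / (1 - c a)) ` A"
    unfolding w using assms by (intro Max_in) auto
  then obtain a where a: "a \<in> A" "w = x a / (1 - c a)"
    by blast
  then have "w * (1 - c a) = x a"
    using assms(3)[OF a(1)] by simp
  then have "w = x a + c a * w"
    by (simp add: algebra_simps)
  with a(1) have "w \<in> (\<lambda>a. x a + c a * w) ` A"
    by blast
  then show ?thesis
    using assms(1) upper by (intro Max_eqI[symmetric]) auto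
qed

text \<open>
  Let \<open>k\<close> be the first state with \<open>w\<^sub>k > v\<^sub>k\<close>, and \<open>d = w\<^sub>k - v\<^sub>k\<close>. States after \<open>k\<close> contribute old
  values and states before \<open>k\<close> contribute values below \<open>v\<close>, so \<open>u k\<close> exceeds \<open>v\<close> at most by \<open>d\<close> at
  \<open>k\<close>. Hence \<open>w\<^sub>k \<le> v\<^sub>k + \<lambda> p\<^sub>k\<^sub>k(a) d < v\<^sub>k + d\<close> for a maximizing \<open>a\<close>, a contradiction.
\<close>

lemma mixed_update_le:
  fixes M :: "('s::{finite, linorder}, 'a) mdp" and u :: "'s \<Rightarrow> 's \<Rightarrow> real"
  assumes M: "discounted_mdp M" and v: "v \<in> V M"
    and mixed: "\<And>i j. u i j = v $ j \<or> u i j = w $ j"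
    and old: "\<And>i j. i < j \<Longrightarrow> u i j = v $ j"
    and w: "\<And>i. w $ i = (MAX a\<in>actions M i. action_value M i a (u i))"
  shows "w $ i \<le> v $ i"
proof (rule ccontr)
  define B where "B = {j. v $ j < w $ j}"
  assume "\<not> w $ i \<le> v $ i"
  then have "B \<noteq> {}"
    by (auto simp: B_def not_le)
  define k where "k = Min B"
  define d where "d = w $ k - v $ k"
  have "k \<in> B"
    unfolding k_def using \<open>B \<noteq> {}\<close> by (intro Min_in) auto
  then have d: "0 < d"
    by (simp add: B_def d_def)
  have before: "w $ j \<le> v $ j" if "j < k" for j
  proof (rule ccontr)
    assume "\<not> w $ j \<le> v $ j"
    then have "k \<le> j"
      unfolding k_def by (intro Min_le) (auto simp: B_def)
    with that show False by simp
  qed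
  have u: "u k j \<le> v $ j + (if j = k then d else 0)" for j
    using mixed[of k j] old[of k j] before[of j] d
    by (cases j k rule: linorder_cases) (auto simp: d_def)
  have "w $ k \<in> (\<lambda>a. action_value M k a (u k)) ` actions M k"
    unfolding w using M by (intro Max_in) (auto simp: discounted_mdp_def)
  then obtain a where a: "a \<in> actions M k" "w $ k = action_value M k a (u k)"
    by blast
  have "w $ k \<le> action_value M k a (\<lambda>j. v $ j + (if j = k then d else 0))"
    unfolding a(2) by (rule action_value_mono[OF M a(1) u])
  also have "\<dots> = action_value M k a (($) v) + discount M * prob M k a k * d"
    by (rule action_value_add_single)
  also have "\<dots> \<le> v $ k + discount M * prob M k a k * d"
    using v a(1) by (simp add: mem_V_iff[OF M])
  also have "\<dots> < v $ k + d"
    using discount_prob_less_1[OF M a(1), of k] d by simp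
  finally show False
    by (simp add: d_def)
qed

lemma mixed_update_in_V:
  fixes M :: "('s::{finite, linorder}, 'a) mdp" and u :: "'s \<Rightarrow> 's \<Rightarrow> real"
  assumes M: "discounted_mdp M" and v: "v \<in> V M"
    and mixed: "\<And>i j. u i j = v $ j \<or> u i j = w $ j"
    and old: "\<And>i j. i < j \<Longrightarrow> u i j = v $ j"
    and w: "\<And>i. w $ i = (MAX a\<in>actions M i. action_value M i a (u i))"
  shows "w \<in> V M"
  unfolding mem_V_iff[OF M]
proof (intro allI ballI)
  fix i a
  assume a: "a \<in> actions M i"
  have "w $ j \<le> u i j" for j
    using mixed[of i j] mixed_update_le[OF assms, of j] by auto
  then have "action_value M i a (($) w) \<le> action_value M i a (u i)"
    by (intro action_value_mono[OF M a])
  also have "\<dots> \<le> w $ i"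
    unfolding w using M a by (intro Max_ge) (auto simp: discounted_mdp_def)
  finally show "action_value M i a (($) w) \<le> w $ i" .
qed

lemma T_J_in_V:
  fixes M :: "('s::{finite, linorder}, 'a) mdp"
  assumes M: "discounted_mdp M" and v: "v \<in> V M"
  shows "T_J M v \<in> V M"
proof -
  define w where "w = T_J M v"
  define u where "u i j = (if j = i then w $ j else v $ j)" for i j
  have "w $ i = (MAX a\<in>actions M i. action_value M i a (u i))" for i
  proof -
    have "w $ i = (MAX a\<in>actions M i.
        (reward M i a + discount M * (\<Sum>j\<in>-{i}. prob M i a j * v $ j))
          / (1 - discount M * prob M i a i))"
      by (simp add: w_def T_J_def)
    then have "w $ i = (MAX a\<in>actions M i.
        (reward M i a + discount M * (\<Sum>j\<in>-{i}. prob M i a j * v $ j))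
          + discount M * prob M i a i * w $ i)"
      using M discount_prob_less_1[OF M]
      by (intro Max_quotient_fixpoint) (auto simp: discounted_mdp_def)
    moreover have "action_value M i a (u i) =
        (reward M i a + discount M * (\<Sum>j\<in>-{i}. prob M i a j * v $ j))
          + discount M * prob M i a i * w $ i" for a
      by (subst action_value_split[of "-{i}" "{i}"]) (auto simp: u_def intro!: sum.cong)
    ultimately show ?thesis by simp
  qed
  then show ?thesis
    unfolding w_def[symmetric] by (intro mixed_update_in_V[OF M v, of u]) (auto simp: u_def)
qed

lemma T_GS_in_V:
  fixes M :: "('s::{finite, linorder}, 'a) mdp"
  assumes M: "discounted_mdp M" and v: "v \<in> V M"
  shows "T_GS M v \<in> V M"
proof -
  define w where "w = T_GS M v"
  define u where "u i j = (if j < i then w $ j else v $ j)" for i j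
  have "action_value M i a (u i) =
      reward M i a + discount M * (\<Sum>j\<in>{..<i}. prob M i a j * w $ j)
        + discount M * (\<Sum>j\<in>{i..}. prob M i a j * v $ j)" for i a
    by (subst action_value_split[of "{..<i}" "{i..}"]) (auto simp: u_def intro!: sum.cong)
  then have "w $ i = (MAX a\<in>actions M i. action_value M i a (u i))" for i
    unfolding w_def by (subst T_GS_nth) simp
  then show ?thesis
    unfolding w_def[symmetric] by (intro mixed_update_in_V[OF M v, of u]) (auto simp: u_def)
qed

lemma T_GSJ_in_V:
  fixes M :: "('s::{finite, linorder}, 'a) mdp"
  assumes M: "discounted_mdp M" and v: "v \<in> V M"
  shows "T_GSJ M v \<in> V M"
proof -
  define w where "w = T_GSJ M v"
  define u where "u i j = (if j \<le> i then w $ j else v $ j)" for i j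
  have "w $ i = (MAX a\<in>actions M i. action_value M i a (u i))" for i
  proof -
    have "w $ i = (MAX a\<in>actions M i.
        (reward M i a + discount M * (\<Sum>j\<in>{..<i}. prob M i a j * w $ j)
          + discount M * (\<Sum>j\<in>{i<..}. prob M i a j * v $ j))
          / (1 - discount M * prob M i a i))"
      unfolding w_def by (rule T_GSJ_nth)
    then have "w $ i = (MAX a\<in>actions M i.
        (reward M i a + discount M * (\<Sum>j\<in>{..<i}. prob M i a j * w $ j)
          + discount M * (\<Sum>j\<in>{i<..}. prob M i a j * v $ j))
          + discount M * prob M i a i * w $ i)"
      using M discount_prob_less_1[OF M]
      by (intro Max_quotient_fixpoint) (auto simp: discounted_mdp_def)
    moreover have "action_value M i a (u i) =
        (reward M i a + discount M * (\<Sum>j\<in>{..<i}. prob M i a j * w $ j)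
          + discount M * (\<Sum>j\<in>{i<..}. prob M i a j * v $ j))
          + discount M * prob M i a i * w $ i" for a
    proof -
      have "{..i} = insert i {..<i}" by auto
      then have "(\<Sum>j\<in>{..i}. prob M i a j * u i j) =
          prob M i a i * w $ i + (\<Sum>j\<in>{..<i}. prob M i a j * w $ j)"
        by (auto simp: u_def intro!: sum.cong)
      moreover have "(\<Sum>j\<in>{i<..}. prob M i a j * u i j) = (\<Sum>j\<in>{i<..}. prob M i a j * v $ j)"
        by (intro sum.cong) (auto simp: u_def)
      ultimately show ?thesis
        by (subst action_value_split[of "{..i}" "{i<..}"]) (auto simp: algebra_simps)
    qed
    ultimately show ?thesis by simp
  qed
  then show ?thesis
    unfolding w_def[symmetric] by (intro mixed_update_in_V[OF M v, of u]) (auto simp: u_def)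
qed

theorem theorem2p3:
  fixes M :: "('s::{finite, linorder}, 'a) mdp"
  assumes "discounted_mdp M"
  shows "T_J M ` V M \<subseteq> V M \<and> T_GS M ` V M \<subseteq> V M \<and> T_GSJ M ` V M \<subseteq> V M"
  using T_J_in_V[OF assms] T_GS_in_V[OF assms] T_GSJ_in_V[OF assms] by blast

end
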